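(* Let $\alpha>0$ be real and define $$f_{\alpha}(x)=(1+x)^{-2\alpha}\sum_{k=0}^{\infty}\binom{-\alpha}{k}^2\left(\frac{x}{1+x}\right)^{2k},\quad x\geq 0.$$ Then $f_\alpha$ is a completely monotonic function.
   Context: Here $\binom{-\alpha}{k}=\frac{(-\alpha)(-\alpha-1)\cdots(-\alpha-k+1)}{k!}$ is the generalized binomial coefficient, and $0^0=1$. A function $f:[0,\infty)\to\mathbb{R}$ is completely monotonic (in the sense of Bernstein's theorem) if it is continuous on $[0,\infty)$, infinitely differentiable on $(0,\infty)$, and $(-1)^m f^{(m)}(x)\geq 0$ for all $x>0$ and all integers $m\geq 0$. *)

theory Defs
  imports "HOL-Analysis.Analysis"
begin

text \<open>
  Functions on \<open>[0,\<infinity>)\<close> are represented by total functions on the reals. The values at negative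
  arguments are irrelevant: each iterated derivative at a point \<open>x > 0\<close> depends only on the
  values near \<open>x\<close>.
\<close>

definition completely_monotonic :: "(real \<Rightarrow> real) \<Rightarrow> bool" where
  "completely_monotonic f \<longleftrightarrow>
     continuous_on {0..} f \<and>
     (\<forall>m. \<forall>x>0. ((deriv ^^ m) f) differentiable (at x)) \<and>
     (\<forall>m. \<forall>x>0. (-1) ^ m * (deriv ^^ m) f x \<ge> 0)"

definition f_alpha :: "real \<Rightarrow> real \<Rightarrow> real" where
  "f_alpha \<alpha> x =
     (1 + x) powr (-2 * \<alpha>) * (\<Sum>k. ((-\<alpha>) gchoose k)\<^sup>2 * (x / (1 + x)) ^ (2 * k))"

text \<open>The series converges on \<open>[0,\<infinity>)\<close>, so the infinite sum has its usual meaning there.\<close>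

lemma summable_f_alpha:
  fixes \<alpha> x :: real
  assumes "x \<ge> 0"
  shows "summable (\<lambda>k. ((-\<alpha>) gchoose k)\<^sup>2 * (x / (1 + x)) ^ (2 * k))"
proof -
  define t where "t = x / (1 + x)"
  have t: "norm t < 1" using assms by (simp add: t_def)
  have "ereal (norm t) < conv_radius (\<lambda>k. (-\<alpha>) gchoose k)"
    using t by (auto simp: conv_radius_gchoose)
  hence s: "summable (\<lambda>k. norm (((-\<alpha>) gchoose k) * t ^ k))"
    by (rule abs_summable_in_conv_radius)
  have "(\<lambda>k. norm (((-\<alpha>) gchoose k) * t ^ k)) \<longlonglongrightarrow> 0"
    by (rule summable_LIMSEQ_zero[OF s])
  hence "eventually (\<lambda>k. norm (((-\<alpha>) gchoose k) * t ^ k) < 1) sequentially"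
    by (rule order_tendstoD) simp
  hence "eventually (\<lambda>k. norm (((-\<alpha>) gchoose k)\<^sup>2 * t ^ (2 * k))
           \<le> norm (((-\<alpha>) gchoose k) * t ^ k)) sequentially"
  proof eventually_elim
    case (elim k)
    define a where "a = ((-\<alpha>) gchoose k) * t ^ k"
    have "norm (((-\<alpha>) gchoose k)\<^sup>2 * t ^ (2 * k)) = norm a * norm a"
      by (simp add: a_def power2_eq_square power_mult abs_mult mult_ac power_mult_distrib)
    also have "\<dots> \<le> norm a * 1"
      using elim by (intro mult_left_mono) (auto simp: a_def)
    finally show ?case by (simp add: a_def)
  qed
  from summable_comparison_test_ev[OF this s] show ?thesis by (simp add: t_def)
qed

end

theory Submission imports Defs begin

text \<open>
  \<open>f_alpha \<alpha>\<close> is the Laplace transform of a probability measure. If \<open>s\<close>, \<open>t\<close> are independent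
  \<open>Gamma(\<alpha>)\<close> variables and \<open>\<theta>\<close> is uniform on \<open>[0, \<pi>]\<close>, then the rate
  \<open>\<bar>\<surd>s - \<surd>t e\<^sup>i\<^sup>\<theta>\<bar>\<^sup>2 = s + t - 2 \<surd>(s t) cos \<theta>\<close> is nonnegative, and averaging \<open>exp (- x rate)\<close> over
  \<open>\<theta>\<close> gives \<open>exp (- x (s + t)) I\<^sub>0 (2 x \<surd>(s t))\<close>. In the series of the Bessel function \<open>I\<^sub>0\<close> the
  variables \<open>s\<close> and \<open>t\<close> separate, and each factor integrates to
  \<open>pochhammer \<alpha> k x\<^sup>k / (k! (1 + x)\<^sup>\<alpha>\<^sup>+\<^sup>k)\<close>, so that the sum over \<open>k\<close> is \<open>f_alpha \<alpha> x\<close>.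
\<close>

subsection \<open>Laplace transforms of finite measures\<close>

text \<open>Derivatives at \<open>x > 0\<close> depend only on values near \<open>x\<close>, and the
  positive half-line is open. This allows \<open>f_alpha\<close> to be replaced by an integral shown
  to agree with it for \<open>x \<ge> 0\<close>.\<close>

lemma completely_monotonic_cong:
  assumes "completely_monotonic g" and eq: "\<And>x. x \<ge> 0 \<Longrightarrow> f x = g x"
  shows "completely_monotonic f"
proof -
  have ev: "eventually (\<lambda>y. f y = g y) (nhds x)" if "x > 0" for x
    using eventually_nhds_in_open[of "{0<..}" x] that
    by (auto elim!: eventually_mono intro!: eq)
  have deriv_eq: "(deriv ^^ m) f x = (deriv ^^ m) g x" if "x > 0" for x m
    by (rule higher_deriv_cong_ev[OF ev[OF that] refl])
  have "(deriv ^^ m) f differentiable (at x)"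
    if "x > 0" "(deriv ^^ m) g differentiable (at x)" for x m
    using has_field_derivative_transform_within_open[of "(deriv ^^ m) g" _ x "{0<..}" "(deriv ^^ m) f"]
      that deriv_eq
    unfolding real_differentiable_def by force
  moreover have "continuous_on {0..} f = continuous_on {0..} g"
    by (rule continuous_on_cong) (auto simp: eq)
  ultimately show ?thesis
    using assms(1) deriv_eq unfolding completely_monotonic_def by simp
qed

text \<open>A single term of the nonnegative series of \<open>exp (c * g)\<close> is at most the
  whole sum. The bound is uniform in \<open>g\<close>, which gives integrability over a finite
  measure.\<close>

lemma power_mult_exp_le:
  fixes c g :: real
  assumes "c > 0" "g \<ge> 0"
  shows "g ^ m * exp (- c * g) \<le> fact m / c ^ m"
proof -
  have "(c * g) ^ m / fact m \<le> exp (c * g)"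
  proof -
    have "(\<lambda>n. (c * g) ^ n /\<^sub>R fact n) sums exp (c * g)"
      by (rule exp_converges)
    from sum_le_suminf[OF sums_summable[OF this], of "{m}"] sums_unique[OF this]
    show ?thesis using assms by (simp add: divide_inverse mult_ac)
  qed
  thus ?thesis
    using assms by (simp add: exp_minus power_mult_distrib field_simps)
qed

text \<open>Mean value inequality on \<open>{c..}\<close>. The bound is free of \<open>x\<close> and
  \<open>y\<close>, so it dominates a whole sequence of difference quotients.\<close>

lemma exp_difference_quotient_bound:
  fixes c g x y :: real
  assumes "c \<le> x" "c \<le> y" "g \<ge> 0"
  shows "\<bar>(exp (- y * g) - exp (- x * g)) / (y - x)\<bar> \<le> g * exp (- c * g)"
\<comment> \<open>For \<open>y = x\<close> the quotient is \<open>0\<close>, as division by zero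
  yields \<open>0\<close>.\<close>
proof (cases "y = x")
  case False
  have "norm (exp (- y * g) - exp (- x * g)) \<le> (g * exp (- c * g)) * norm (y - x)"
  proof (rule field_differentiable_bound[of "{c..}" "\<lambda>z. exp (- z * g)" "\<lambda>z. - g * exp (- z * g)"])
    show "norm (- g * exp (- z * g)) \<le> g * exp (- c * g)" if "z \<in> {c..}" for z
      using that assms by (auto simp: abs_mult intro!: mult_left_mono mult_right_mono)
  qed (use assms in \<open>auto intro!: derivative_eq_intros\<close>)
  thus ?thesis using False by (simp add: field_simps)
qed (use assms in auto)

context finite_measure
begin

context
  fixes g :: "'a \<Rightarrow> real"
  assumes g [measurable]: "g \<in> borel_measurable M" and g_nonneg: "\<And>w. g w \<ge> 0"
begin

lemma integrable_power_mult_exp: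
  assumes "x > 0"
  shows "integrable M (\<lambda>w. g w ^ m * exp (- x * g w))"
proof (rule integrable_const_bound[of _ "fact m / x ^ m"])
  show "AE w in M. norm (g w ^ m * exp (- x * g w)) \<le> fact m / x ^ m"
    using power_mult_exp_le[OF assms g_nonneg] g_nonneg by (auto simp: abs_mult)
qed measurable

text \<open>Differentiation under the integral sign, by dominated convergence of the difference
  quotients along sequences tending to \<open>x\<close>.\<close>

lemma has_field_derivative_Laplace:
  assumes "x > 0"
  shows "((\<lambda>x. \<integral>w. (- g w) ^ m * exp (- x * g w) \<partial>M) has_field_derivative
           (\<integral>w. (- g w) ^ Suc m * exp (- x * g w) \<partial>M)) (at x)"
proof -
  let ?h = "\<lambda>y w. (- g w) ^ m * exp (- y * g w)"
  let ?F = "\<lambda>y. \<integral>w. ?h y w \<partial>M"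
  have int: "integrable M (?h y)" if "y > 0" for y
    using integrable_mult_right[OF integrable_power_mult_exp[OF that, of m], of "(-1) ^ m"]
    by (simp add: power_minus[of "g _"] mult_ac)
  \<comment> \<open>Beyond \<open>x/2\<close> the decay rate stays away from 0, so one integrable
    function dominates all quotients. The set is an open neighbourhood of \<open>x\<close>, hence
    the limit is the full derivative.\<close>
  have "((\<lambda>y. (?F y - ?F x) / (y - x)) \<longlongrightarrow> (\<integral>w. (- g w) ^ Suc m * exp (- x * g w) \<partial>M))
          (at x within {x/2<..})"
    unfolding tendsto_at_iff_sequentially comp_def
  proof (intro allI impI)
    fix X assume X: "\<forall>i. X i \<in> {x/2<..} - {x}" "X \<longlonglongrightarrow> x"
    let ?q = "\<lambda>i w. (?h (X i) w - ?h x w) / (X i - x)"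
    have "(\<lambda>i. \<integral>w. ?q i w \<partial>M) \<longlonglongrightarrow> (\<integral>w. (- g w) ^ Suc m * exp (- x * g w) \<partial>M)"
    proof (rule integral_dominated_convergence[where w = "\<lambda>w. g w ^ Suc m * exp (- (x/2) * g w)"])
      show "integrable M (\<lambda>w. g w ^ Suc m * exp (- (x/2) * g w))"
        using assms by (intro integrable_power_mult_exp) simp
      show "AE w in M. (\<lambda>i. ?q i w) \<longlonglongrightarrow> (- g w) ^ Suc m * exp (- x * g w)"
      proof (intro AE_I2)
        fix w
        have "((\<lambda>y. ?h y w) has_field_derivative (- g w) ^ Suc m * exp (- x * g w)) 
                (at x within {x/2<..})"
          by (auto intro!: derivative_eq_intros)
        thus "(\<lambda>i. ?q i w) \<longlonglongrightarrow> (- g w) ^ Suc m * exp (- x * g w)"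
          using X unfolding has_field_derivative_iff tendsto_at_iff_sequentially comp_def by blast
      qed
      show "AE w in M. norm (?q i w) \<le> g w ^ Suc m * exp (- (x/2) * g w)" for i
      proof (intro AE_I2)
        fix w
        have "norm (?q i w) = g w ^ m * \<bar>(exp (- X i * g w) - exp (- x * g w)) / (X i - x)\<bar>"
          using g_nonneg[of w]
          by (simp add: abs_mult power_abs flip: right_diff_distrib)
        also have "\<dots> \<le> g w ^ m * (g w * exp (- (x/2) * g w))"
          using X assms g_nonneg[of w]
          by (intro mult_left_mono exp_difference_quotient_bound) (auto simp: less_imp_le)
        finally show "norm (?q i w) \<le> g w ^ Suc m * exp (- (x/2) * g w)"
          by (simp add: mult_ac)
      qed
    qed measurable
    also have "(\<lambda>i. \<integral>w. ?q i w \<partial>M) = (\<lambda>i. (?F (X i) - ?F x) / (X i - x))"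
    proof
      fix i
      have "X i > x / 2" using X by auto
      hence "X i > 0" using assms by simp
      show "(\<integral>w. ?q i w \<partial>M) = (?F (X i) - ?F x) / (X i - x)"
        using int[OF \<open>X i > 0\<close>] int[OF assms] by simp
    qed
    finally show "(\<lambda>i. (?F (X i) - ?F x) / (X i - x)) \<longlonglongrightarrow>
        (\<integral>w. (- g w) ^ Suc m * exp (- x * g w) \<partial>M)" .
  qed
  moreover have "at x within {x/2<..} = at x"
    using assms by (intro at_within_open) auto
  ultimately show ?thesis
    unfolding has_field_derivative_iff by simp
qed

text \<open>The easy half of Bernstein's theorem: each derivative brings down a factor
  \<open>- g w\<close>. Continuity gets its own argument because the derivative formula covers only
  \<open>x > 0\<close>.\<close>

lemma completely_monotonic_Laplace:
  "completely_monotonic (\<lambda>x. \<integral>w. exp (- x * g w) \<partial>M)"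
proof -
  let ?L = "\<lambda>x. \<integral>w. exp (- x * g w) \<partial>M"
  let ?D = "\<lambda>m x. \<integral>w. (- g w) ^ m * exp (- x * g w) \<partial>M"
  have D: "(deriv ^^ m) ?L x = ?D m x" if "x > 0" for m x
    using that
  proof (induction m arbitrary: x)
    case (Suc m)
    have "eventually (\<lambda>y. (deriv ^^ m) ?L y = ?D m y) (nhds x)"
      using eventually_nhds_in_open[of "{0<..}" x] Suc
      by (auto elim!: eventually_mono)
    hence "deriv ((deriv ^^ m) ?L) x = deriv (?D m) x"
      by (rule deriv_cong_ev) simp
    thus ?case
      using DERIV_imp_deriv[OF has_field_derivative_Laplace[OF Suc.prems]] by simp
  qed simp
  have "continuous_on {0..} ?L"
    unfolding continuous_on_def tendsto_at_iff_sequentially comp_def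
  proof (intro ballI allI impI)
    fix x X assume x: "x \<in> {0::real..}" and X: "\<forall>i. X i \<in> {0..} - {x}" "X \<longlonglongrightarrow> x"
    show "(\<lambda>i. ?L (X i)) \<longlonglongrightarrow> ?L x"
    \<comment> \<open>The constant \<open>1\<close> also dominates at the endpoint \<open>0\<close>,
      and it is integrable because the measure is finite.\<close>
    proof (rule integral_dominated_convergence[where w = "\<lambda>_. 1"])
      show "AE w in M. (\<lambda>i. exp (- X i * g w)) \<longlonglongrightarrow> exp (- x * g w)"
        using X by (auto intro!: tendsto_intros)
      show "AE w in M. norm (exp (- X i * g w)) \<le> 1" for i
        using X g_nonneg by auto
    qed auto
  qed
  moreover have "(deriv ^^ m) ?L differentiable (at x)" if "x > 0" for m x
  proof -
    have "((deriv ^^ m) ?L has_field_derivative ?D (Suc m) x) (at x)"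
    proof (rule has_field_derivative_transform_within_open)
      show "(?D m has_field_derivative ?D (Suc m) x) (at x)"
        by (rule has_field_derivative_Laplace[OF that])
      show "?D m y = (deriv ^^ m) ?L y" if "y \<in> {0<..}" for y
        using D[of y m] that by simp
    qed (use that in auto)
    thus ?thesis
      unfolding real_differentiable_def by blast
  qed
  moreover have "(-1) ^ m * (deriv ^^ m) ?L x \<ge> 0" if "x > 0" for m x
  proof -
    have "(-1) ^ m * (deriv ^^ m) ?L x = (\<integral>w. (-1) ^ m * ((- g w) ^ m * exp (- x * g w)) \<partial>M)"
      by (simp only: D[OF that] integral_mult_right_zero)
    also have "\<dots> = (\<integral>w. g w ^ m * exp (- x * g w) \<partial>M)"
    proof (intro Bochner_Integration.integral_cong refl)
      have "(-1) ^ m * (- g w) ^ m = g w ^ m" for w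
        by (simp flip: power_mult_distrib)
      thus "(-1) ^ m * ((- g w) ^ m * exp (- x * g w)) = g w ^ m * exp (- x * g w)" for w
        by (simp only: mult.assoc[symmetric])
    qed
    also have "\<dots> \<ge> 0"
      using g_nonneg by (intro Bochner_Integration.integral_nonneg) simp
    finally show ?thesis .
  qed
  ultimately show ?thesis
    unfolding completely_monotonic_def by blast
qed

end

end

subsection \<open>The Gamma distribution\<close>

text \<open>Substitution of \<open>c * s\<close> in Euler's integral for
  \<open>Gamma a\<close>.\<close>

lemma nn_integral_Gamma_scaled:
  fixes a c :: real
  assumes "a > 0" "c > 0"
  shows "(\<integral>\<^sup>+s. ennreal (indicator {0<..} s * s powr (a - 1) * exp (- c * s)) \<partial>lborel)
           = ennreal (Gamma a * c powr (- a))"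
proof -
  let ?J = "\<integral>\<^sup>+s. ennreal (indicator {0<..} s * s powr (a - 1) * exp (- c * s)) \<partial>lborel"
  have "ennreal (Gamma a) = \<bar>c\<bar> * (\<integral>\<^sup>+s. ennreal (indicator {0..} (0 + c * s) *
          (0 + c * s) powr (a - 1) / exp (0 + c * s)) \<partial>lborel)"
    unfolding Gamma_conv_nn_integral_real[OF assms(1)]
    using assms by (intro nn_integral_real_affine) auto
  \<comment> \<open>Passing from \<open>{0..}\<close> to \<open>{0<..}\<close> changes nothing at
    \<open>s = 0\<close>, since \<open>0 powr (a - 1) = 0\<close>.\<close>
  also have "(\<integral>\<^sup>+s. ennreal (indicator {0..} (0 + c * s) *
          (0 + c * s) powr (a - 1) / exp (0 + c * s)) \<partial>lborel) =
        (\<integral>\<^sup>+s. ennreal (c powr (a - 1)) *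
          ennreal (indicator {0<..} s * s powr (a - 1) * exp (- c * s)) \<partial>lborel)"
    using assms
    by (intro nn_integral_cong)
       (auto simp: indicator_def powr_mult exp_minus field_simps zero_le_mult_iff
             simp flip: ennreal_mult)
  also have "\<dots> = ennreal (c powr (a - 1)) * ?J"
    by (intro nn_integral_cmult) auto
  also have "ennreal \<bar>c\<bar> * \<dots> = ennreal (c powr a) * ?J"
    using assms by (simp add: powr_diff mult.assoc[symmetric] flip: ennreal_mult)
  \<comment> \<open>Multiplying by the inverse constant solves for \<open>?J\<close> without
    assuming it finite.\<close>
  finally have "ennreal (c powr (- a)) * ennreal (Gamma a) =
      ennreal (c powr (- a)) * (ennreal (c powr a) * ?J)" by simp
  also have "\<dots> = ?J"
    using assms by (simp add: mult.assoc[symmetric] flip: ennreal_mult powr_add)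
  finally show ?thesis
    using assms by (simp add: mult.commute flip: ennreal_mult)
qed

definition gamma_measure :: "real \<Rightarrow> real measure" where
  "gamma_measure a =
     density lborel (\<lambda>s. ennreal (indicator {0<..} s * s powr (a - 1) * exp (- s) / Gamma a))"

lemma sets_gamma_measure [measurable_cong, simp]: "sets (gamma_measure a) = sets borel"
  by (simp add: gamma_measure_def)

lemma nn_integral_gamma_measure:
  assumes [measurable]: "h \<in> borel_measurable borel"
  shows "(\<integral>\<^sup>+s. h s \<partial>gamma_measure a) =
    (\<integral>\<^sup>+s. ennreal (indicator {0<..} s * s powr (a - 1) * exp (- s) / Gamma a) * h s \<partial>lborel)"
  unfolding gamma_measure_def by (rule nn_integral_density) auto

lemma AE_gamma_measure: "AE s in gamma_measure a. s > 0"
  unfolding gamma_measure_def by (subst AE_density) (auto simp: indicator_def)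

text \<open>The integrand turns the density into an unnormalised Gamma density of shape
  \<open>a + k\<close> and rate \<open>1 + x\<close>; \<open>Gamma (a + k) / Gamma a\<close> is the
  Pochhammer symbol.\<close>

lemma nn_integral_gamma_measure_power_exp:
  assumes "a > 0" "x \<ge> 0"
  shows "(\<integral>\<^sup>+s. ennreal (s ^ k * exp (- x * s)) \<partial>gamma_measure a)
           = ennreal (pochhammer a k * (1 + x) powr (- (a + real k)))"
proof -
  have powr_eq: "s powr (a + real k - 1) = s powr (a - 1) * s ^ k" if "s > 0" for s
    using powr_add[of s "a - 1" "real k"] that by (simp add: powr_realpow algebra_simps)
  have exp_eq: "exp (- (1 + x) * s) = exp (- s) * exp (- x * s)" for s
    by (simp add: algebra_simps flip: exp_add)
  have "(\<integral>\<^sup>+s. ennreal (s ^ k * exp (- x * s)) \<partial>gamma_measure a) =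
     (\<integral>\<^sup>+s. ennreal (1 / Gamma a) *
        ennreal (indicator {0<..} s * s powr ((a + k) - 1) * exp (- (1 + x) * s)) \<partial>lborel)"
  proof (subst nn_integral_gamma_measure, measurable, intro nn_integral_cong)
    fix s :: real
    show "ennreal (indicator {0<..} s * s powr (a - 1) * exp (- s) / Gamma a) *
        ennreal (s ^ k * exp (- x * s)) = ennreal (1 / Gamma a) *
        ennreal (indicator {0<..} s * s powr ((a + k) - 1) * exp (- (1 + x) * s))"
    proof (cases "s > 0")
      case True
      show ?thesis
        unfolding exp_eq powr_eq[OF True] using True assms
        by (simp add: mult_ac flip: ennreal_mult)
    qed auto
  qed
  also have "\<dots> = ennreal (1 / Gamma a) * ennreal (Gamma (a + k) * (1 + x) powr (- (a + k)))"
    using assms by (subst nn_integral_cmult, measurable) (subst nn_integral_Gamma_scaled, auto)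
  also have "\<dots> = ennreal (pochhammer a k * (1 + x) powr (- (a + real k)))"
    using assms by (subst pochhammer_Gamma) (auto elim!: nonpos_Ints_cases simp flip: ennreal_mult)
  finally show ?thesis .
qed

lemma finite_measure_gamma_measure:
  assumes "a > 0"
  shows "finite_measure (gamma_measure a)"
  \<comment> \<open>With \<open>k = 0\<close> and \<open>x = 0\<close> the integral is the total
    mass, namely 1.\<close>
  using nn_integral_gamma_measure_power_exp[OF assms, of 0 0]
  by (intro finite_measureI) simp

subsection \<open>The modified Bessel function as a mixture of exponentials\<close>

definition cos_moment :: "nat \<Rightarrow> real" where
  "cos_moment n = (\<integral>\<theta>. cos \<theta> ^ n * indicator {0..pi} \<theta> \<partial>lborel)"

lemma integrable_cos_power: "integrable lborel (\<lambda>\<theta>. cos \<theta> ^ n * indicator {0..pi} \<theta> :: real)"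
  by (intro borel_integrable_atLeastAtMost) (auto intro!: continuous_intros)

lemma cos_moment_0: "cos_moment 0 = pi"
  by (simp add: cos_moment_def)

lemma cos_moment_1: "cos_moment 1 = 0"
proof -
  have "cos_moment 1 = sin pi - sin 0"
    unfolding cos_moment_def
    by (subst integral_FTC_Icc_real[where F = sin and f = "\<lambda>x. cos x ^ 1"])
       (auto intro!: derivative_eq_intros continuous_intros)
  thus ?thesis by simp
qed

text \<open>The function \<open>cos \<theta> ^ Suc n * sin \<theta>\<close> is a primitive of the
  difference of the two integrands and vanishes at \<open>0\<close> and \<open>pi\<close>.\<close>

lemma cos_moment_Suc_Suc: "(real n + 2) * cos_moment (Suc (Suc n)) = (real n + 1) * cos_moment n"
proof -
  let ?f = "\<lambda>\<theta>. (real n + 2) * cos \<theta> ^ Suc (Suc n) - (real n + 1) * cos \<theta> ^ n"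
  have "(real n + 2) * cos_moment (Suc (Suc n)) - (real n + 1) * cos_moment n =
      (\<integral>\<theta>. (real n + 2) * (cos \<theta> ^ Suc (Suc n) * indicator {0..pi} \<theta>) -
            (real n + 1) * (cos \<theta> ^ n * indicator {0..pi} \<theta>) \<partial>lborel)"
    unfolding cos_moment_def
    by (simp only: integral_mult_right_zero Bochner_Integration.integral_diff
          integrable_mult_right integrable_cos_power)
  also have "\<dots> = (\<integral>\<theta>. ?f \<theta> * indicator {0..pi} \<theta> \<partial>lborel)"
    by (intro Bochner_Integration.integral_cong) (auto simp: algebra_simps)
  also have "\<dots> = cos pi ^ Suc n * sin pi - cos 0 ^ Suc n * sin 0"
  proof (rule integral_FTC_Icc_real)
    fix \<theta> :: real
    have s: "sin \<theta> * sin \<theta> = 1 - cos \<theta> * cos \<theta>"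
      using sin_cos_squared_add3[of \<theta>] by linarith
    have "((\<lambda>\<theta>. cos \<theta> ^ Suc n * sin \<theta>) has_real_derivative
       cos \<theta> ^ Suc n * cos \<theta> - (real n + 1) * cos \<theta> ^ n * (sin \<theta> * sin \<theta>)) (at \<theta>)"
      by (rule derivative_eq_intros refl | simp add: algebra_simps)+
    thus "((\<lambda>\<theta>. cos \<theta> ^ Suc n * sin \<theta>) has_real_derivative ?f \<theta>) (at \<theta>)"
      unfolding s by (simp add: algebra_simps)
  qed (auto intro!: continuous_intros)
  finally show ?thesis by simp
qed

text \<open>Wallis' integrals: the recurrence factor is the ratio of consecutive values of the
  central binomial coefficient divided by \<open>4 ^ k\<close>.\<close>

lemma cos_moment_even: "cos_moment (2 * k) = pi * fact (2 * k) / (4 ^ k * (fact k)\<^sup>2)"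
proof (induction k)
  case (Suc k)
  have "(2 * real k + 2) * cos_moment (2 * Suc k) = (2 * real k + 1) * cos_moment (2 * k)"
    using cos_moment_Suc_Suc[of "2 * k"] by simp
  hence "cos_moment (2 * Suc k) = (2 * real k + 1) / (2 * real k + 2) * cos_moment (2 * k)"
    by (simp add: field_simps)
  also have "\<dots> = pi * fact (2 * Suc k) / (4 ^ Suc k * (fact (Suc k))\<^sup>2)"
    unfolding Suc.IH by (simp add: divide_simps power2_eq_square) (simp add: algebra_simps)
  finally show ?case .
qed (simp add: cos_moment_0)

lemma cos_moment_odd: "cos_moment (2 * k + 1) = 0"
proof (induction k)
  case (Suc k)
  show ?case using cos_moment_Suc_Suc[of "2 * k + 1"] Suc by simp
qed (use cos_moment_1 in simp)

definition arc_measure :: "real measure" where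
  "arc_measure = density lborel (\<lambda>\<theta>. ennreal (indicator {0..pi} \<theta> / pi))"

lemma sets_arc_measure [measurable_cong, simp]: "sets arc_measure = sets borel"
  by (simp add: arc_measure_def)

lemma finite_measure_arc_measure: "finite_measure arc_measure"
proof (rule finite_measureI)
  have "emeasure arc_measure (space arc_measure) =
      (\<integral>\<^sup>+\<theta>. ennreal (1 / pi) * indicator {0..pi} \<theta> \<partial>lborel)"
    unfolding arc_measure_def
    by (subst emeasure_density) (auto intro!: nn_integral_cong simp: indicator_def)
  thus "emeasure arc_measure (space arc_measure) \<noteq> \<infinity>"
    by (simp add: nn_integral_cmult_indicator ennreal_mult_eq_top_iff)
qed

text \<open>The exponential series is integrated term by term against the cosine moments; the factor
  \<open>fact (2 * k)\<close> cancels and leaves squares.\<close>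

lemma cos_exp_sums:
  "(\<lambda>k. pi * ((u / 2) ^ k / fact k)\<^sup>2) sums (\<integral>\<theta>. exp (u * cos \<theta>) * indicator {0..pi} \<theta> \<partial>lborel)"
proof -
  have four_power: "(4 :: real) ^ k = (2 ^ k)\<^sup>2" for k
    by (simp add: power2_eq_square flip: power_mult_distrib)
  let ?f = "\<lambda>n \<theta>. u ^ n / fact n * (cos \<theta> ^ n * indicator {0..pi} \<theta>) :: real"
  have exp_sums: "(\<lambda>n. ?f n \<theta>) sums (exp (u * cos \<theta>) * indicator {0..pi} \<theta>)" for \<theta>
    using sums_mult2[OF exp_converges[of "u * cos \<theta>"], of "indicator {0..pi} \<theta>"]
    by (simp add: power_mult_distrib field_simps)
  have summable_exp: "summable (\<lambda>n. \<bar>u\<bar> ^ n / fact n)"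
    using sums_summable[OF exp_converges[of "\<bar>u\<bar>"]] by (simp add: field_simps)
  have bound: "norm (?f n \<theta>) \<le> \<bar>u\<bar> ^ n / fact n * indicator {0..pi} \<theta>" for n \<theta>
    by (auto simp: abs_mult power_abs indicator_def intro!: divide_right_mono mult_left_le power_le_one)
  have int: "integrable lborel (?f n)" for n
    by (intro integrable_mult_right integrable_cos_power)
  \<comment> \<open>The exchange is justified by the majorant
    \<open>\<bar>u\<bar> ^ n / fact n\<close> on \<open>{0..pi}\<close>, whose integrals are
    summable.\<close>
  have "(\<lambda>n. \<integral>\<theta>. ?f n \<theta> \<partial>lborel) sums (\<integral>\<theta>. (\<Sum>n. ?f n \<theta>) \<partial>lborel)"
  proof (rule sums_integral[OF int])
    show "AE \<theta> in lborel. summable (\<lambda>n. norm (?f n \<theta>))"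
    proof (intro AE_I2)
      fix \<theta>
      show "summable (\<lambda>n. norm (?f n \<theta>))"
        by (rule summable_comparison_test'[OF summable_mult2[OF summable_exp]])
           (use bound in auto)
    qed
    show "summable (\<lambda>n. \<integral>\<theta>. norm (?f n \<theta>) \<partial>lborel)"
    proof (rule summable_comparison_test'[OF summable_mult2[OF summable_exp, of pi]])
      fix n
      have "(\<integral>\<theta>. norm (?f n \<theta>) \<partial>lborel) \<le> (\<integral>\<theta>. \<bar>u\<bar> ^ n / fact n * indicator {0..pi} \<theta> \<partial>lborel)"
        using int[of n] bound by (intro integral_mono integrable_norm) auto
      thus "norm (\<integral>\<theta>. norm (?f n \<theta>) \<partial>lborel) \<le> \<bar>u\<bar> ^ n / fact n * pi"
        by (simp add: integral_nonneg)
    qed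
  qed
  hence "(\<lambda>n. u ^ n / fact n * cos_moment n) sums
      (\<integral>\<theta>. exp (u * cos \<theta>) * indicator {0..pi} \<theta> \<partial>lborel)"
    using exp_sums[THEN sums_unique] by (simp add: cos_moment_def)
  \<comment> \<open>Odd moments vanish, so the series may be reindexed by even exponents.\<close>
  also have "?this \<longleftrightarrow> (\<lambda>k. u ^ (2 * k) / fact (2 * k) * cos_moment (2 * k)) sums
      (\<integral>\<theta>. exp (u * cos \<theta>) * indicator {0..pi} \<theta> \<partial>lborel)"
  proof (rule sums_mono_reindex[symmetric])
    show "u ^ n / fact n * cos_moment n = 0" if "n \<notin> range (\<lambda>k. 2 * k)" for n
      using that cos_moment_odd by (cases "even n") (auto elim!: evenE oddE)
  qed (auto simp: strict_mono_def)
  also have "(\<lambda>k. u ^ (2 * k) / fact (2 * k) * cos_moment (2 * k)) =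
      (\<lambda>k. pi * ((u / 2) ^ k / fact k)\<^sup>2)"
    by (simp add: cos_moment_even four_power power_divide power_mult_distrib fun_eq_iff power_even_eq
          flip: power2_eq_square)
  finally show ?thesis .
qed

text \<open>The right-hand side is \<open>I\<^sub>0 u\<close>.\<close>

lemma nn_integral_arc_measure_exp_cos:
  "(\<integral>\<^sup>+\<theta>. ennreal (exp (u * cos \<theta>)) \<partial>arc_measure) = (\<Sum>k. ennreal (((u / 2) ^ k / fact k)\<^sup>2))"
proof -
  have int: "integrable lborel (\<lambda>\<theta>. exp (u * cos \<theta>) * indicator {0..pi} \<theta> :: real)"
    by (intro borel_integrable_atLeastAtMost) (auto intro!: continuous_intros)
  have sums: "(\<lambda>k. ((u / 2) ^ k / fact k)\<^sup>2) sums
      ((\<integral>\<theta>. exp (u * cos \<theta>) * indicator {0..pi} \<theta> \<partial>lborel) / pi)"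
    using sums_divide[OF cos_exp_sums, of u pi] by simp
  have "(\<integral>\<^sup>+\<theta>. ennreal (exp (u * cos \<theta>)) \<partial>arc_measure) =
      (\<integral>\<^sup>+\<theta>. ennreal (exp (u * cos \<theta>) * indicator {0..pi} \<theta> / pi) \<partial>lborel)"
    unfolding arc_measure_def
    by (subst nn_integral_density) (auto intro!: nn_integral_cong simp: mult.commute simp flip: ennreal_mult)
  also have "\<dots> = ennreal ((\<integral>\<theta>. exp (u * cos \<theta>) * indicator {0..pi} \<theta> \<partial>lborel) / pi)"
    using int by (subst nn_integral_eq_integral) auto
  also have "\<dots> = (\<Sum>k. ennreal (((u / 2) ^ k / fact k)\<^sup>2))"
    using sums by (subst suminf_ennreal2) (auto simp: sums_iff)
  finally show ?thesis .
qed

subsection \<open>The mixture representation\<close>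

definition mixing_measure :: "real \<Rightarrow> (real \<times> real \<times> real) measure" where
  "mixing_measure \<alpha> = gamma_measure \<alpha> \<Otimes>\<^sub>M (gamma_measure \<alpha> \<Otimes>\<^sub>M arc_measure)"

text \<open>Written as a sum of squares, the rate is nonnegative also for negative \<open>s\<close> and \<open>t\<close>, where
  Isabelle's \<open>sqrt\<close> is negative.\<close>

definition rate :: "real \<times> real \<times> real \<Rightarrow> real" where
  "rate = (\<lambda>(s, t, \<theta>). (sqrt s - sqrt t * cos \<theta>)\<^sup>2 + (sqrt t * sin \<theta>)\<^sup>2)"

lemma rate_nonneg: "rate w \<ge> 0"
  by (cases w) (auto simp: rate_def)

text \<open>Law of cosines for a triangle with sides \<open>sqrt s\<close> and
  \<open>sqrt t\<close>.\<close>

lemma rate_eq: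
  assumes "s \<ge> 0" "t \<ge> 0"
  shows "rate (s, t, \<theta>) = s + t - 2 * (sqrt s * sqrt t) * cos \<theta>"
proof -
  have "rate (s, t, \<theta>) = (sqrt s)\<^sup>2 + (sqrt t)\<^sup>2 * ((sin \<theta>)\<^sup>2 + (cos \<theta>)\<^sup>2) - 2 * (sqrt s * sqrt t) * cos \<theta>"
    unfolding rate_def by (simp only: prod.case) algebra
  thus ?thesis using assms by simp
qed

lemma measurable_rate [measurable]: "rate \<in> borel_measurable (mixing_measure \<alpha>)"
  unfolding rate_def mixing_measure_def by measurable

text \<open>Only even powers of \<open>?u\<close> occur in the Bessel series, so the square roots
  disappear and each term is a product of a function of \<open>s\<close> and a function of
  \<open>t\<close>.\<close>

lemma nn_integral_arc_measure_rate:
  assumes "s > 0" "t > 0" "x \<ge> 0"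
  shows "(\<integral>\<^sup>+\<theta>. ennreal (exp (- x * rate (s, t, \<theta>))) \<partial>arc_measure) =
    (\<Sum>k. ennreal ((x ^ k / fact k)\<^sup>2) * ennreal (s ^ k * exp (- x * s)) * ennreal (t ^ k * exp (- x * t)))"
proof -
  let ?u = "2 * x * (sqrt s * sqrt t)"
  have "(\<integral>\<^sup>+\<theta>. ennreal (exp (- x * rate (s, t, \<theta>))) \<partial>arc_measure) =
      (\<integral>\<^sup>+\<theta>. ennreal (exp (- x * s) * exp (- x * t)) * ennreal (exp (?u * cos \<theta>)) \<partial>arc_measure)"
    using assms
    by (intro nn_integral_cong)
       (simp add: rate_eq algebra_simps flip: ennreal_mult exp_add)
  also have "\<dots> = ennreal (exp (- x * s) * exp (- x * t)) * (\<Sum>k. ennreal (((?u / 2) ^ k / fact k)\<^sup>2))"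
    by (subst nn_integral_cmult) (auto simp: nn_integral_arc_measure_exp_cos)
  also have "\<dots> = (\<Sum>k. ennreal (exp (- x * s) * exp (- x * t)) * ennreal (((?u / 2) ^ k / fact k)\<^sup>2))"
    by simp
  also have "\<dots> = (\<Sum>k. ennreal ((x ^ k / fact k)\<^sup>2) * ennreal (s ^ k * exp (- x * s)) *
                        ennreal (t ^ k * exp (- x * t)))"
  proof (intro suminf_cong)
    fix k
    have "((?u / 2) ^ k)\<^sup>2 = (x ^ k)\<^sup>2 * (((sqrt s)\<^sup>2) ^ k * ((sqrt t)\<^sup>2) ^ k)"
      by (simp add: power_mult_distrib power2_eq_square del: real_sqrt_mult_self)
    also have "\<dots> = (x ^ k)\<^sup>2 * (s ^ k * t ^ k)"
      using assms by simp
    finally show "ennreal (exp (- x * s) * exp (- x * t)) * ennreal (((?u / 2) ^ k / fact k)\<^sup>2) =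
        ennreal ((x ^ k / fact k)\<^sup>2) * ennreal (s ^ k * exp (- x * s)) * ennreal (t ^ k * exp (- x * t))"
      using assms by (simp add: power_divide mult_ac flip: ennreal_mult)
  qed
  finally show ?thesis .
qed

lemma finite_measure_mixing_measure:
  assumes "\<alpha> > 0"
  shows "finite_measure (mixing_measure \<alpha>)"
  unfolding mixing_measure_def
  by (intro finite_measure_pair_measure finite_measure_gamma_measure[OF assms] finite_measure_arc_measure)

text \<open>The binomial coefficient is \<open>(-1) ^ k * pochhammer \<alpha> k / fact k\<close>,
  and squaring removes the sign. The right-hand side shows two equal Gamma integrals, one each for
  \<open>s\<close> and \<open>t\<close>.\<close>

lemma f_alpha_term:
  assumes "x \<ge> 0"
  shows "(1 + x) powr (-2 * \<alpha>) * (((-\<alpha>) gchoose k)\<^sup>2 * (x / (1 + x)) ^ (2 * k)) =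
    (x ^ k / fact k)\<^sup>2 * (pochhammer \<alpha> k * (1 + x) powr (- (\<alpha> + real k)))\<^sup>2"
proof -
  have "(1 + x) powr (- (\<alpha> + real k)) = (1 + x) powr (- \<alpha>) / (1 + x) ^ k"
    using assms powr_diff[of "1 + x" "- \<alpha>" "real k"] by (simp add: powr_realpow)
  moreover have "((1 + x) powr (- \<alpha>))\<^sup>2 = (1 + x) powr (-2 * \<alpha>)"
    by (simp add: power2_eq_square flip: powr_add)
  moreover have "(((-1) ^ k)\<^sup>2 :: real) = 1"
    by (simp flip: power_mult)
  ultimately show ?thesis
    by (simp add: gbinomial_pochhammer power_mult_distrib power_divide power_mult[of _ k 2]
          mult.commute[of 2 k])
qed

lemma nn_integral_mixing_measure:
  assumes "\<alpha> > 0" "x \<ge> 0"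
  shows "(\<integral>\<^sup>+w. ennreal (exp (- x * rate w)) \<partial>mixing_measure \<alpha>) = ennreal (f_alpha \<alpha> x)"
proof -
  interpret arc: finite_measure arc_measure
    by (rule finite_measure_arc_measure)
  interpret G: finite_measure "gamma_measure \<alpha>"
    using assms(1) by (rule finite_measure_gamma_measure)
  interpret GA: finite_measure "gamma_measure \<alpha> \<Otimes>\<^sub>M arc_measure"
    by (intro finite_measure_pair_measure finite_measure_gamma_measure[OF assms(1)]
        finite_measure_arc_measure)
  let ?c = "\<lambda>k. ennreal ((x ^ k / fact k)\<^sup>2)"
  let ?h = "\<lambda>k s. ennreal (s ^ k * exp (- x * s))"
  let ?p = "\<lambda>k. pochhammer \<alpha> k * (1 + x) powr (- (\<alpha> + real k))"
  note [measurable] = measurable_rate[of \<alpha>, unfolded mixing_measure_def]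
  have "(\<integral>\<^sup>+w. ennreal (exp (- x * rate w)) \<partial>mixing_measure \<alpha>) =
      (\<integral>\<^sup>+s. \<integral>\<^sup>+v. ennreal (exp (- x * rate (s, v))) \<partial>(gamma_measure \<alpha> \<Otimes>\<^sub>M arc_measure) \<partial>gamma_measure \<alpha>)"
    unfolding mixing_measure_def by (subst GA.nn_integral_fst[symmetric]) auto
  also have "\<dots> = (\<integral>\<^sup>+s. \<integral>\<^sup>+t. \<integral>\<^sup>+\<theta>. ennreal (exp (- x * rate (s, t, \<theta>)))
      \<partial>arc_measure \<partial>gamma_measure \<alpha> \<partial>gamma_measure \<alpha>)"
    by (intro nn_integral_cong) (subst arc.nn_integral_fst[symmetric], auto)
  \<comment> \<open>The series for the inner integral is available for positive \<open>s\<close> and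
    \<open>t\<close>, hence almost everywhere.\<close>
  also have "\<dots> = (\<integral>\<^sup>+s. \<integral>\<^sup>+t. (\<Sum>k. ?c k * ?h k s * ?h k t) \<partial>gamma_measure \<alpha> \<partial>gamma_measure \<alpha>)"
    using AE_gamma_measure[of \<alpha>]
  proof (intro nn_integral_cong_AE, eventually_elim)
    case (elim s)
    show ?case
      using AE_gamma_measure[of \<alpha>]
    proof (intro nn_integral_cong_AE, eventually_elim)
      case (elim t)
      thus ?case using \<open>s > 0\<close> assms(2) by (rule_tac nn_integral_arc_measure_rate)
    qed
  qed
  \<comment> \<open>Sum and integral commute because all terms are nonnegative; \<open>t\<close> is
    integrated out first, then \<open>s\<close>.\<close>
  also have "\<dots> = (\<integral>\<^sup>+s. (\<Sum>k. ?c k * ?h k s * ennreal (?p k)) \<partial>gamma_measure \<alpha>)"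
    by (subst nn_integral_suminf, measurable)
       (simp add: nn_integral_cmult nn_integral_gamma_measure_power_exp[OF assms, simplified])
  also have "\<dots> = (\<Sum>k. ?c k * ennreal (?p k) * ennreal (?p k))"
    by (subst nn_integral_suminf, measurable)
       (simp add: nn_integral_cmult nn_integral_multc
          nn_integral_gamma_measure_power_exp[OF assms, simplified])
  also have "\<dots> = (\<Sum>k. ennreal ((1 + x) powr (-2 * \<alpha>) *
      (((-\<alpha>) gchoose k)\<^sup>2 * (x / (1 + x)) ^ (2 * k))))"
    unfolding f_alpha_term[OF assms(2)]
    using assms by (simp add: power2_eq_square[of "_ * _"] pochhammer_nonneg mult.assoc flip: ennreal_mult)
  \<comment> \<open>Summability of the real series identifies its extended sum with the real
    one.\<close>
  also have "\<dots> = ennreal (f_alpha \<alpha> x)"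
    unfolding f_alpha_def using summable_f_alpha[OF assms(2), of \<alpha>]
    by (subst suminf_ennreal2) (auto simp: suminf_mult intro!: summable_mult)
  finally show ?thesis .
qed

theorem theorem2p1:
  fixes \<alpha> :: real
  assumes "\<alpha> > 0"
  shows "completely_monotonic (f_alpha \<alpha>)"
proof (rule completely_monotonic_cong)
  interpret finite_measure "mixing_measure \<alpha>"
    using assms by (rule finite_measure_mixing_measure)
  show "completely_monotonic (\<lambda>x. \<integral>w. exp (- x * rate w) \<partial>mixing_measure \<alpha>)"
    by (intro completely_monotonic_Laplace measurable_rate rate_nonneg)
  show "f_alpha \<alpha> x = (\<integral>w. exp (- x * rate w) \<partial>mixing_measure \<alpha>)" if "x \<ge> 0" for x
  proof -
    \<comment> \<open>Since \<open>ennreal\<close> sends negative reals to \<open>0\<close>,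
      nonnegativity is what recovers the real value from the extended integral.\<close>
    have "f_alpha \<alpha> x \<ge> 0"
      unfolding f_alpha_def using summable_f_alpha[OF that]
      by (intro mult_nonneg_nonneg suminf_nonneg) auto
    thus ?thesis
      by (subst integral_eq_nn_integral) (auto simp: nn_integral_mixing_measure[OF assms that, simplified])
  qed
qed

end
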